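(* Let $\zeta:L_3\longrightarrow\mathrm{GL}_3(\mathbb{C})$ be a non-trivial $2$-local representation of the triplet group $L_3$ (not necessarily homogeneous). Then $\zeta$ is equivalent to exactly one of the following four representations, given by pairs $\zeta(\ell_1)=L_1$ and $\zeta(\ell_2)=L_2$, where the matrices $L_1$ and $L_2$ are of the form \[ L_1=\begin{pmatrix} a & b & 0\\ c & d & 0\\ 0 & 0 & 1\end{pmatrix},\qquad L_2=\begin{pmatrix} 1 & 0 & 0\\ 0 & e & f\\ 0 & g & h\end{pmatrix}, \] and belong to one of the following families. (1) \[ L_1^{(1)}=\begin{pmatrix} \frac{e}{1-e} & b & 0\\ \frac{1-2e}{b(e-1)^2} & \frac{e}{e-1} & 0\\ 0&0&1\end{pmatrix},\qquad L_2^{(1)}=\begin{pmatrix} 1&0&0\\ 0&e&f\\ 0&\frac{1-e^2}{f}&-e\end{pmatrix}, \] where $b,e,f\in\mathbb{C}$, $b\neq0$, $e\neq1$, $f\neq0$. (2) \[ L_1^{(2)}=\begin{pmatrix} -\frac12 & b & 0\\ \frac{3}{4b} & \frac12 & 0\\ 0&0&1\end{pmatrix},\qquad L_2^{(2)}=\begin{pmatrix} 1&0&0\\ 0&-1&0\\ 0&g&1\end{pmatrix}, \] where $b,g\in\mathbb{C}$, $b\neq0$. (3) \[ L_1^{(3)}=\begin{pmatrix} 1&0&0\\ c&-1&0\\ 0&0&1\end{pmatrix},\qquad L_2^{(3)}=\begin{pmatrix} 1&0&0\\ 0&\frac12&f\\ 0&\frac{3}{4f}&-\frac12\end{pmatrix},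 \] where $c,f\in\mathbb{C}$, $f\neq0$. (4) \[ L_1^{(4)}=\begin{pmatrix} 1&0&0\\ 0&-1&0\\ 0&0&1\end{pmatrix},\qquad L_2^{(4)}=\begin{pmatrix} 1&0&0\\ 0&-1&0\\ 0&0&1\end{pmatrix}. \]
   Context: The triplet group $L_3$ is the group $\langle \ell_1,\ell_2\mid \ell_1^2=\ell_2^2=1,\ \ell_1\ell_2\ell_1=\ell_2\ell_1\ell_2\rangle$. A representation $\zeta:L_3\to\mathrm{GL}_3(\mathbb{C})$ is $2$-local if $\zeta(\ell_1)=\begin{pmatrix} M_1&0\\0&1\end{pmatrix}$ and $\zeta(\ell_2)=\begin{pmatrix}1&0\\0&M_2\end{pmatrix}$ for some $M_1,M_2\in\mathrm{GL}_2(\mathbb{C})$; it is homogeneous if $M_1=M_2$. It is non-trivial if it does not send both generators to the identity matrix.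
   Formalization: Families (1)–(3) are conjugate to one another, so "equivalent to exactly one" fails up to equivalence; the formal theorem instead says that the pair (ζ(ℓ1), ζ(ℓ2)) itself belongs to exactly one of the four families, and hence ζ is equivalent to a member of one. *)

theory Defs
  imports "HOL-Analysis.Analysis" "HOL-Algebra.Group"
begin

section \<open>Groups given by generators and relations\<close>

text \<open>
  A word is a list of signed generators: \<open>(x, True)\<close> stands for \<open>x\<close> and
  \<open>(x, False)\<close> for its formal inverse.  A relation \<open>u = v\<close> is the pair \<open>(u, v)\<close>.
\<close>

type_synonym 'g word = "('g \<times> bool) list"

inductive pres_eq :: "('g word \<times> 'g word) set \<Rightarrow> 'g word \<Rightarrow> 'g word \<Rightarrow> bool"
  for R :: "('g word \<times> 'g word) set" where
  refl: "pres_eq R w w"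
| sym: "pres_eq R u v \<Longrightarrow> pres_eq R v u"
| trans: "pres_eq R u v \<Longrightarrow> pres_eq R v w \<Longrightarrow> pres_eq R u w"
| cong: "pres_eq R u v \<Longrightarrow> pres_eq R (a @ u @ b) (a @ v @ b)"
| cancel: "pres_eq R [(x, s), (x, \<not> s)] []"
| rel: "(u, v) \<in> R \<Longrightarrow> pres_eq R u v"

definition word_class :: "('g word \<times> 'g word) set \<Rightarrow> 'g word \<Rightarrow> 'g word set" where
  "word_class R u = {w. pres_eq R u w}"

definition presented_group :: "('g word \<times> 'g word) set \<Rightarrow> 'g word set monoid" where
  "presented_group R =
     \<lparr>carrier = range (word_class R),
      mult = (\<lambda>A B. {w. \<exists>u\<in>A. \<exists>v\<in>B. pres_eq R (u @ v) w}),
      one = word_class R []\<rparr>"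

lemma word_class_eq_iff: "word_class R u = word_class R v \<longleftrightarrow> pres_eq R u v"
  unfolding word_class_def
  by (auto intro: pres_eq.refl pres_eq.sym pres_eq.trans)

lemma pres_eq_append:
  assumes "pres_eq R u u'" "pres_eq R v v'"
  shows "pres_eq R (u @ v) (u' @ v')"
  using pres_eq.cong[OF assms(1), of "[]" v] pres_eq.cong[OF assms(2), of u' "[]"]
  by (auto intro: pres_eq.trans)

lemma presented_group_mult:
  "word_class R u \<otimes>\<^bsub>presented_group R\<^esub> word_class R v = word_class R (u @ v)"
  unfolding presented_group_def word_class_def
  by (auto intro: pres_eq.refl pres_eq.trans pres_eq_append)

lemma pres_eq_inverse:
  "pres_eq R (rev (map (\<lambda>(x, s). (x, \<not> s)) w) @ w) []"
proof (induction w)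
  case Nil
  show ?case by (simp add: pres_eq.refl)
next
  case (Cons l w)
  obtain x s where l: "l = (x, s)" by (cases l)
  let ?i = "rev (map (\<lambda>(x, s). (x, \<not> s)) w)"
  have "pres_eq R [(x, \<not> s), (x, \<not> \<not> s)] []" by (rule pres_eq.cancel)
  from pres_eq.cong[OF this, of ?i w]
  have "pres_eq R (?i @ [(x, \<not> s), (x, s)] @ w) (?i @ w)" by simp
  then show ?case using Cons.IH l by (auto intro: pres_eq.trans)
qed

lemma group_presented_group: "group (presented_group R)"
proof (rule groupI)
  fix A B assume "A \<in> carrier (presented_group R)" "B \<in> carrier (presented_group R)"
  then obtain u v where "A = word_class R u" "B = word_class R v"
    by (auto simp: presented_group_def)
  then show "A \<otimes>\<^bsub>presented_group R\<^esub> B \<in> carrier (presented_group R)"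
    by (simp add: presented_group_mult) (simp add: presented_group_def)
next
  show "\<one>\<^bsub>presented_group R\<^esub> \<in> carrier (presented_group R)"
    by (simp add: presented_group_def)
next
  fix A B C
  assume "A \<in> carrier (presented_group R)" "B \<in> carrier (presented_group R)"
    "C \<in> carrier (presented_group R)"
  then obtain u v w where "A = word_class R u" "B = word_class R v" "C = word_class R w"
    by (auto simp: presented_group_def)
  then show "A \<otimes>\<^bsub>presented_group R\<^esub> B \<otimes>\<^bsub>presented_group R\<^esub> C =
      A \<otimes>\<^bsub>presented_group R\<^esub> (B \<otimes>\<^bsub>presented_group R\<^esub> C)"
    by (simp add: presented_group_mult)
next
  fix A assume "A \<in> carrier (presented_group R)"
  then obtain u where A: "A = word_class R u" by (auto simp: presented_group_def)
  have one: "\<one>\<^bsub>presented_group R\<^esub> = word_class R []" by (simp add: presented_group_def)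
  show "\<one>\<^bsub>presented_group R\<^esub> \<otimes>\<^bsub>presented_group R\<^esub> A = A"
    by (simp add: A one presented_group_mult)
  let ?B = "word_class R (rev (map (\<lambda>(x, s). (x, \<not> s)) u))"
  have "?B \<otimes>\<^bsub>presented_group R\<^esub> A = \<one>\<^bsub>presented_group R\<^esub>"
    by (simp add: A one presented_group_mult word_class_eq_iff pres_eq_inverse)
  moreover have "?B \<in> carrier (presented_group R)" by (simp add: presented_group_def)
  ultimately show "\<exists>B\<in>carrier (presented_group R). B \<otimes>\<^bsub>presented_group R\<^esub> A = \<one>\<^bsub>presented_group R\<^esub>"
    by blast
qed

section \<open>The triplet group on two generators\<close>

datatype triplet_gen = Gen1 | Gen2

definition triplet_relations :: "(triplet_gen word \<times> triplet_gen word) set" where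
  "triplet_relations =
     (let l1 = (Gen1, True); l2 = (Gen2, True) in
       {([l1, l1], []), ([l2, l2], []), ([l1, l2, l1], [l2, l1, l2])})"

definition L3 :: "triplet_gen word set monoid" where
  "L3 = presented_group triplet_relations"

definition ell1 :: "triplet_gen word set" where
  "ell1 = word_class triplet_relations [(Gen1, True)]"

definition ell2 :: "triplet_gen word set" where
  "ell2 = word_class triplet_relations [(Gen2, True)]"

section \<open>Matrix representations\<close>

definition GL :: "(complex^'n^'n) monoid" where
  "GL = \<lparr>carrier = {A. invertible A}, mult = (**), one = mat 1\<rparr>"

lemma group_GL: "group (GL :: (complex^'n^'n) monoid)"
proof (rule groupI)
  fix A :: "complex^'n^'n" assume "A \<in> carrier GL"
  then obtain B where "A ** B = mat 1" "B ** A = mat 1"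
    by (auto simp: GL_def invertible_def)
  then show "\<exists>B\<in>carrier GL. B \<otimes>\<^bsub>GL\<^esub> A = \<one>\<^bsub>GL\<^esub>"
    by (auto simp: GL_def invertible_def)
qed (auto simp: GL_def invertible_mult matrix_mul_assoc invertible_def[of "mat 1"])

definition equivalent_reps ::
  "('a, 'b) monoid_scheme \<Rightarrow> ('a \<Rightarrow> complex^'n^'n) \<Rightarrow> ('a \<Rightarrow> complex^'n^'n) \<Rightarrow> bool" where
  "equivalent_reps G \<zeta> \<rho> \<longleftrightarrow>
     (\<exists>P. invertible P \<and> (\<forall>x\<in>carrier G. \<rho> x = P ** \<zeta> x ** matrix_inv P))"

definition block_M_1 :: "complex^2^2 \<Rightarrow> complex^3^3" where
  "block_M_1 M = vector [vector [M$1$1, M$1$2, 0],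
                         vector [M$2$1, M$2$2, 0],
                         vector [0,     0,     1]]"

definition block_1_M :: "complex^2^2 \<Rightarrow> complex^3^3" where
  "block_1_M M = vector [vector [1, 0,     0],
                         vector [0, M$1$1, M$1$2],
                         vector [0, M$2$1, M$2$2]]"

definition two_local :: "(triplet_gen word set \<Rightarrow> complex^3^3) \<Rightarrow> bool" where
  "two_local \<zeta> \<longleftrightarrow>
     (\<exists>M1 M2. invertible M1 \<and> invertible M2 \<and> \<zeta> ell1 = block_M_1 M1 \<and> \<zeta> ell2 = block_1_M M2)"

definition nontrivial_rep :: "(triplet_gen word set \<Rightarrow> complex^3^3) \<Rightarrow> bool" where
  "nontrivial_rep \<zeta> \<longleftrightarrow> \<not> (\<zeta> ell1 = mat 1 \<and> \<zeta> ell2 = mat 1)"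

section \<open>The four families of pairs of matrices\<close>

definition L1_form :: "complex \<Rightarrow> complex \<Rightarrow> complex \<Rightarrow> complex \<Rightarrow> complex^3^3" where
  "L1_form a b c d = vector [vector [a, b, 0],
                             vector [c, d, 0],
                             vector [0, 0, 1]]"

definition L2_form :: "complex \<Rightarrow> complex \<Rightarrow> complex \<Rightarrow> complex \<Rightarrow> complex^3^3" where
  "L2_form e f g h = vector [vector [1, 0, 0],
                             vector [0, e, f],
                             vector [0, g, h]]"

datatype family_index = Fam1 | Fam2 | Fam3 | Fam4

fun family :: "family_index \<Rightarrow> ((complex^3^3) \<times> (complex^3^3)) set" where
  "family Fam1 =
     {(L1_form (e / (1 - e)) b ((1 - 2 * e) / (b * (e - 1)\<^sup>2)) (e / (e - 1)),
       L2_form e f ((1 - e\<^sup>2) / f) (- e)) | b e f. b \<noteq> 0 \<and> e \<noteq> 1 \<and> f \<noteq> 0}"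
| "family Fam2 =
     {(L1_form (- 1 / 2) b (3 / (4 * b)) (1 / 2), L2_form (- 1) 0 g 1) | b g. b \<noteq> 0}"
| "family Fam3 =
     {(L1_form 1 0 c (- 1), L2_form (1 / 2) f (3 / (4 * f)) (- 1 / 2)) | c f. f \<noteq> 0}"
| "family Fam4 = {(L1_form 1 0 0 (- 1), L2_form (- 1) 0 0 1)}"

end

theory Submission
  imports Defs
begin

text \<open>
  A representation \<open>\<zeta>\<close> is determined by the images \<open>L1_form a b c d\<close> and \<open>L2_form e f g h\<close> of the
  two generators, and the three defining relations become polynomial equations in the eight
  entries.  Solving them shows that the pair of images already lies in one of the four families,
  so that \<open>\<zeta>\<close> itself serves as the representative.

  The two upper off-diagonal entries \<open>b\<close> and \<open>f\<close> decide which family it is: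
  Families 1, 2, 3 and 4 are those with \<open>b \<noteq> 0 \<noteq> f\<close>, \<open>b \<noteq> 0 = f\<close>, \<open>b = 0 \<noteq> f\<close> and \<open>b = 0 = f\<close>.
  Hence they are disjoint (\<open>family_determines_zero_pattern\<close>).
  For existence, a non-zero off-diagonal entry of an involutive block makes its trace vanish, and
  what is left is to express all entries through the free ones.
  If \<open>b \<noteq> 0\<close>, the braid relation gives \<open>a (1 - e) = e\<close>, so that \<open>e \<noteq> 1\<close> and \<open>a = e / (1 - e)\<close>.
  If \<open>b = 0\<close>, then \<open>a\<^sup>2 = d\<^sup>2 = 1\<close> and the braid relation excludes \<open>a = -1\<close>; the sign \<open>d = 1\<close> forces
  both matrices to be the identity, while \<open>d = -1\<close> leaves \<open>e = 1/2\<close>, which is Family 3, or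
  \<open>e = -1\<close>, which is Family 4.
\<close>

section \<open>The relations as equations of matrix entries\<close>

lemma L1_form_involution_iff:
  "L1_form a b c d ** L1_form a b c d = mat 1 \<longleftrightarrow>
     a * a + b * c = 1 \<and> a * b + b * d = 0 \<and> c * a + d * c = 0 \<and> c * b + d * d = 1"
  by (simp add: L1_form_def vec_eq_iff forall_3 matrix_matrix_mult_def sum_3 mat_def)

lemma L2_form_involution_iff:
  "L2_form e f g h ** L2_form e f g h = mat 1 \<longleftrightarrow>
     e * e + f * g = 1 \<and> e * f + f * h = 0 \<and> g * e + h * g = 0 \<and> g * f + h * h = 1"
  by (simp add: L2_form_def vec_eq_iff forall_3 matrix_matrix_mult_def sum_3 mat_def)

lemma braid_relation_entries:
  assumes "L1_form a b c d ** L2_form e f g h ** L1_form a b c d =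
           L2_form e f g h ** L1_form a b c d ** L2_form e f g h"
  shows "a * a + b * e * c = a" "a * b + b * e * d = b * e" "c * a + d * e * c = e * c"
    "c * b + d * e * d = e * d * e + f * g" "d * f = e * d * f + f * h"
    "g * d = g * d * e + h * g" "h = g * d * f + h * h"
  using assms
  by (simp_all add: L1_form_def L2_form_def vec_eq_iff forall_3 matrix_matrix_mult_def sum_3)

lemma L1_form_eq_iff:
  "L1_form a b c d = L1_form a' b' c' d' \<longleftrightarrow> a = a' \<and> b = b' \<and> c = c' \<and> d = d'"
  by (auto simp: L1_form_def vec_eq_iff forall_3)

lemma L2_form_eq_iff:
  "L2_form e f g h = L2_form e' f' g' h' \<longleftrightarrow> e = e' \<and> f = f' \<and> g = g' \<and> h = h'"
  by (auto simp: L2_form_def vec_eq_iff forall_3)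

lemma L1_form_identity: "L1_form 1 0 0 1 = mat 1"
  by (simp add: L1_form_def vec_eq_iff forall_3 mat_def)

lemma L2_form_identity: "L2_form 1 0 0 1 = mat 1"
  by (simp add: L2_form_def vec_eq_iff forall_3 mat_def)

section \<open>Solving the equations\<close>

lemma family_determines_zero_pattern:
  assumes "(L1_form a b c d, L2_form e f g h) \<in> family k"
  shows "k = (if b = 0 then if f = 0 then Fam4 else Fam3
              else if f = 0 then Fam2 else Fam1)"
  using assms by (cases k) (auto simp: L1_form_eq_iff L2_form_eq_iff)

text \<open>
  Since \<open>b = 0\<close>, the diagonal entries of the first block are its eigenvalues \<open>\<plusminus>1\<close>, and the braid
  relation says \<open>a = a\<^sup>2\<close>, so only the sign of \<open>d\<close> is open.  For \<open>d = -1\<close>, eliminating \<open>f g\<close> between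
  the braid relation and \<open>e\<^sup>2 + f g = 1\<close> gives \<open>(2 e - 1) (e + 1) = 0\<close>, and each root belongs to one
  family.
\<close>

lemma triplet_pair_lower_triangular:
  fixes a c d e f g h :: complex
  assumes inv1: "L1_form a 0 c d ** L1_form a 0 c d = mat 1"
    and inv2: "L2_form e f g h ** L2_form e f g h = mat 1"
    and braid: "L1_form a 0 c d ** L2_form e f g h ** L1_form a 0 c d =
                L2_form e f g h ** L1_form a 0 c d ** L2_form e f g h"
    and nontriv: "\<not> (L1_form a 0 c d = mat 1 \<and> L2_form e f g h = mat 1)"
  shows "(L1_form a 0 c d, L2_form e f g h) \<in> family Fam3 \<union> family Fam4"
proof -
  note i1 = inv1[unfolded L1_form_involution_iff]
  note i2 = inv2[unfolded L2_form_involution_iff]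
  note br = braid_relation_entries[OF braid]
  have a: "a = 1" using i1 br(1) by simp
  have "d * d = 1" using i1 by simp
  then have "d = 1 \<or> d = - 1" by (simp add: square_eq_1_iff)
  moreover have "d \<noteq> 1"
  proof
    assume d: "d = 1"
    have c: "c = 0" using i1 a d by simp
    have e: "e = 1" using br(4) c d i2 by simp
    have "h \<noteq> 0" using br(7) d i2 by auto
    then have f: "f = 0" and g: "g = 0" using br(5,6) d e by auto
    have h: "h = 1" using br(7) \<open>h \<noteq> 0\<close> f by simp
    show False using nontriv a c d e f g h by (simp add: L1_form_identity L2_form_identity)
  qed
  ultimately have d: "d = - 1" by blast
  have "f * g = 1 - e * e" using i2 by (simp add: eq_diff_eq add.commute)
  then have "e = 1 - 2 * (e * e)" using br(4) d by simp
  then have "(2 * e - 1) * (e + 1) = 0" by (simp add: algebra_simps)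
  then have "2 * e = 1 \<or> e = - 1" by (simp add: eq_neg_iff_add_eq_0)
  then have "e = 1 / 2 \<or> e = - 1" by (simp add: eq_divide_eq mult.commute)
  then show ?thesis
  proof
    assume e: "e = 1 / 2"
    have fg: "f * g = 3 / 4" using i2 e by (simp add: field_simps)
    then have f: "f \<noteq> 0" by auto
    then have g: "g = 3 / (4 * f)" using fg by (simp add: field_simps)
    have "f * (e + h) = 0" using i2 by (simp add: algebra_simps)
    then have h: "h = - 1 / 2" using f e by (simp add: add_eq_0_iff)
    have "(L1_form a 0 c d, L2_form e f g h) \<in> family Fam3"
      unfolding family.simps using a d e f g h by blast
    then show ?thesis by blast
  next
    assume e: "e = - 1"
    have c: "c = 0" using br(3) a d e by (simp add: algebra_simps)
    have "f * g = 0" using i2 e by simp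
    then have h: "h = 1" using i2 br(7) d by (auto simp: algebra_simps)
    have f: "f = 0" and g: "g = 0" using br(5,6) d e h by (auto simp: algebra_simps)
    show ?thesis using a c d e f g h by simp
  qed
qed

text \<open>
  With \<open>b \<noteq> 0\<close> the parameters \<open>b\<close> and \<open>e\<close> determine the first block; if moreover \<open>f = 0\<close>, then
  \<open>e\<^sup>2 = 1\<close> together with \<open>e \<noteq> 1\<close> leaves only \<open>e = -1\<close>.
\<close>

lemma triplet_pair_nonzero_upper_entry:
  fixes a b c d e f g h :: complex
  assumes inv1: "L1_form a b c d ** L1_form a b c d = mat 1"
    and inv2: "L2_form e f g h ** L2_form e f g h = mat 1"
    and braid: "L1_form a b c d ** L2_form e f g h ** L1_form a b c d =
                L2_form e f g h ** L1_form a b c d ** L2_form e f g h"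
    and b: "b \<noteq> 0"
  shows "(L1_form a b c d, L2_form e f g h) \<in> family Fam1 \<union> family Fam2"
proof -
  note i1 = inv1[unfolded L1_form_involution_iff]
  note i2 = inv2[unfolded L2_form_involution_iff]
  note br = braid_relation_entries[OF braid]
  have "b * (a + d) = 0" using i1 by (simp add: algebra_simps)
  then have d: "d = - a" using b by (simp add: add_eq_0_iff)
  have "b * (a * (1 - e)) = b * e" using br(2) d by (simp add: algebra_simps)
  then have ae: "a * (1 - e) = e" using b by (metis mult_left_cancel)
  then have e: "e \<noteq> 1" by auto
  then have a: "a = e / (1 - e)" using ae by (simp add: field_simps)
  have d': "d = e / (e - 1)" using d a e by (simp add: divide_simps) (simp add: algebra_simps)
  have "c * b = 1 - a * a" using i1 by (simp add: eq_diff_eq algebra_simps)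
  then have "c * b * (e - 1)\<^sup>2 = (1 - a * a) * (e - 1)\<^sup>2" by simp
  also have "\<dots> = (e - 1)\<^sup>2 - (a * (1 - e))\<^sup>2" by (simp add: power2_eq_square algebra_simps)
  also have "\<dots> = 1 - 2 * e" unfolding ae by (simp add: power2_eq_square algebra_simps)
  finally have c: "c = (1 - 2 * e) / (b * (e - 1)\<^sup>2)" using b e by (simp add: field_simps)
  show ?thesis
  proof (cases "f = 0")
    case False
    have "f * (e + h) = 0" using i2 by (simp add: algebra_simps)
    then have h: "h = - e" using False by (simp add: add_eq_0_iff)
    have "f * g = 1 - e\<^sup>2" using i2 by (simp add: power2_eq_square algebra_simps)
    then have "g = (1 - e\<^sup>2) / f" using False by (simp add: field_simps)
    then show ?thesis using a b c d' e h False by auto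
  next
    case True
    then have "e * e = 1" using i2 by simp
    then have e': "e = - 1" using e by (simp add: square_eq_1_iff)
    have "h = 1" using i2 br(7) True by auto
    moreover have "a = - 1 / 2" "d = 1 / 2" "c = 3 / (4 * b)"
      using a d c e' by (simp_all add: mult.commute)
    ultimately have "(L1_form a b c d, L2_form e f g h) \<in> family Fam2"
      unfolding family.simps using b e' True by blast
    then show ?thesis by blast
  qed
qed

section \<open>Representations of the triplet group\<close>

lemma L3_generator_relations:
  "ell1 \<otimes>\<^bsub>L3\<^esub> ell1 = \<one>\<^bsub>L3\<^esub>" "ell2 \<otimes>\<^bsub>L3\<^esub> ell2 = \<one>\<^bsub>L3\<^esub>"
  "ell1 \<otimes>\<^bsub>L3\<^esub> ell2 \<otimes>\<^bsub>L3\<^esub> ell1 = ell2 \<otimes>\<^bsub>L3\<^esub> ell1 \<otimes>\<^bsub>L3\<^esub> ell2"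
proof -
  have one: "\<one>\<^bsub>L3\<^esub> = word_class triplet_relations []"
    by (simp add: L3_def presented_group_def)
  show "ell1 \<otimes>\<^bsub>L3\<^esub> ell1 = \<one>\<^bsub>L3\<^esub>" "ell2 \<otimes>\<^bsub>L3\<^esub> ell2 = \<one>\<^bsub>L3\<^esub>"
    "ell1 \<otimes>\<^bsub>L3\<^esub> ell2 \<otimes>\<^bsub>L3\<^esub> ell1 = ell2 \<otimes>\<^bsub>L3\<^esub> ell1 \<otimes>\<^bsub>L3\<^esub> ell2"
    unfolding one
    by (auto simp: L3_def ell1_def ell2_def presented_group_mult word_class_eq_iff
        triplet_relations_def Let_def intro!: pres_eq.rel)
qed

lemma L3_rep_matrix_relations:
  fixes \<zeta> :: "triplet_gen word set \<Rightarrow> complex^'n^'n"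
  assumes "\<zeta> \<in> hom L3 GL"
  shows "\<zeta> ell1 ** \<zeta> ell1 = mat 1" "\<zeta> ell2 ** \<zeta> ell2 = mat 1"
    "\<zeta> ell1 ** \<zeta> ell2 ** \<zeta> ell1 = \<zeta> ell2 ** \<zeta> ell1 ** \<zeta> ell2"
proof -
  interpret L3: group L3 by (simp add: L3_def group_presented_group)
  have gens: "ell1 \<in> carrier L3" "ell2 \<in> carrier L3"
    by (auto simp: L3_def ell1_def ell2_def presented_group_def)
  have mult: "\<zeta> (x \<otimes>\<^bsub>L3\<^esub> y) = \<zeta> x ** \<zeta> y"
    if "x \<in> carrier L3" "y \<in> carrier L3" for x y
    using hom_mult[OF assms that] by (simp add: GL_def)
  have one: "\<zeta> \<one>\<^bsub>L3\<^esub> = mat 1"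
    using hom_one[OF assms L3.is_group group_GL] by (simp add: GL_def)
  show "\<zeta> ell1 ** \<zeta> ell1 = mat 1" "\<zeta> ell2 ** \<zeta> ell2 = mat 1"
    using gens by (simp_all flip: mult add: L3_generator_relations one)
  show "\<zeta> ell1 ** \<zeta> ell2 ** \<zeta> ell1 = \<zeta> ell2 ** \<zeta> ell1 ** \<zeta> ell2"
    using arg_cong[OF L3_generator_relations(3), of \<zeta>] gens by (simp add: mult)
qed

lemma equivalent_reps_refl:
  fixes \<zeta> :: "'a \<Rightarrow> complex^'n^'n"
  shows "equivalent_reps G \<zeta> \<zeta>"
proof -
  have "invertible (mat 1 :: complex^'n^'n)"
    by (auto simp: invertible_def)
  then have "matrix_inv (mat 1) = (mat 1 :: complex^'n^'n)"
    by (simp add: matrix_inv_def)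
  then show ?thesis
    unfolding equivalent_reps_def using \<open>invertible (mat 1)\<close> by (intro exI[of _ "mat 1"]) simp
qed

theorem theorem22:
  fixes \<zeta> :: "triplet_gen word set \<Rightarrow> complex^3^3"
  assumes "\<zeta> \<in> hom L3 GL"
    and "two_local \<zeta>"
    and "nontrivial_rep \<zeta>"
  shows "(\<exists>k. \<exists>\<rho>\<in>hom L3 GL. (\<rho> ell1, \<rho> ell2) \<in> family k \<and> equivalent_reps L3 \<zeta> \<rho>) \<and>
         (\<exists>!k. (\<zeta> ell1, \<zeta> ell2) \<in> family k)"
proof -
  obtain a b c d e f g h where
    images: "\<zeta> ell1 = L1_form a b c d" "\<zeta> ell2 = L2_form e f g h"
    using assms(2) unfolding two_local_def block_M_1_def block_1_M_def L1_form_def L2_form_def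
    by blast
  note rels = L3_rep_matrix_relations[OF assms(1), unfolded images]
  have nontriv: "\<not> (L1_form a b c d = mat 1 \<and> L2_form e f g h = mat 1)"
    using assms(3) by (simp add: nontrivial_rep_def images)
  have "(L1_form a b c d, L2_form e f g h) \<in>
      family Fam1 \<union> family Fam2 \<union> (family Fam3 \<union> family Fam4)"
  proof (cases "b = 0")
    case True
    from triplet_pair_lower_triangular[OF rels[unfolded True] nontriv[unfolded True]] True
    show ?thesis by blast
  next
    case False
    from triplet_pair_nonzero_upper_entry[OF rels False] show ?thesis by blast
  qed
  then obtain k where k: "(\<zeta> ell1, \<zeta> ell2) \<in> family k"
    unfolding images by blast
  moreover have "k' = k" if "(\<zeta> ell1, \<zeta> ell2) \<in> family k'" for k'
    using family_determines_zero_pattern that k unfolding images by metis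
  ultimately show ?thesis
    using assms(1) equivalent_reps_refl by blast
qed

end
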